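(* Let $F$ be a field of characteristic $0$. All possible decompositions of $F[x,y]$ into a direct sum of two nonzero subalgebras, each of which has a basis consisting of monomials, are, up to the action of $\psi_{x,y}$, the following: I) $F[x,y] = F^*[x,y] \oplus F1$; II) $F[x,y] = \langle x\rangle_{\mathrm{ideal}}\oplus F[y]$; III) $F[x,y] = (\langle x\rangle_{\mathrm{ideal}}\oplus F1)\oplus F^{*}[y]$; IV) $F[x,y] = (\mathrm{Span}\{x^ky^l\mid (k,l)\in\mathbb{N}^2\setminus\{(0,0)\},\ \alpha k > l\}\oplus F1)\oplus \mathrm{Span}\{x^ky^l\mid (k,l)\in\mathbb{N}^2\setminus\{(0,0)\},\ \alpha k\leq l\}$, where $\alpha\in\mathbb{Q}$, $\alpha>0$; V) $F[x,y] = (\mathrm{Span}\{x^ky^l\mid (k,l)\in\mathbb{N}^2\setminus\{(0,0)\},\ \alpha k \geq l\}\oplus F1)\oplus \mathrm{Span}\{x^ky^l\mid (k,l)\in\mathbb{N}^2\setminus\{(0,0)\},\ \alpha k < l\}$, where $\alpha\in\mathbb{Q}$, $\alpha>0$; VI) $F[x,y] = (\mathrm{Span}\{x^ky^l\mid (k,l)\in\mathbb{N}^2\setminus\{(0,0)\},\ \alpha k > l\}\oplus F1)\oplus \mathrm{Span}\{x^ky^l\mid (k,l)\in\mathbb{N}^2\setminus\{(0,0)\},\ \alpha k< l\}$, where $\alpha\in\mathbb{R}\setminus\mathbb{Q}$, $\alpha>0$.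
   Context: $\mathbb{N}=\{0,1,2,\ldots\}$. Subalgebras are not required to contain the unit $1$. A decomposition $F[x,y]=A\oplus B$ means that $F[x,y]$ is the direct sum, as a vector space, of its two subalgebras $A$ and $B$; the order of the two summands is not taken into account. $F^*[x,y]$ and $F^*[y]$ denote the sets of polynomials with zero constant term in $F[x,y]$ and $F[y]$ respectively; $\langle x\rangle_{\mathrm{ideal}}$ is the ideal of $F[x,y]$ generated by $x$; $F1$ is the set of constant polynomials. $\mathrm{Span}$ denotes the linear span over $F$. $\psi_{x,y}$ is the automorphism of $F[x,y]$ interchanging $x$ and $y$; it acts on decompositions by $A\oplus B\mapsto \psi_{x,y}(A)\oplus\psi_{x,y}(B)$. *)

theory Defs
  imports Complex_Main "HOL-Library.Poly_Mapping" "HOL-Library.Product_Plus"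
begin

text \<open>
  The ring \<open>F[x,y]\<close> is the monoid algebra of \<open>\<nat> \<times> \<nat>\<close> over \<open>F\<close>: the coefficient of \<open>x^k y^l\<close> in
  \<open>p\<close> is \<open>Poly_Mapping.lookup p (k, l)\<close>, and the product of \<^typ>\<open>'a \<Rightarrow>\<^sub>0 'b\<close> is convolution.
\<close>

type_synonym 'a bipoly = "(nat \<times> nat) \<Rightarrow>\<^sub>0 'a"

definition varX :: "'a::comm_ring_1 bipoly"
  where "varX = Poly_Mapping.single (1, 0) 1"

definition varY :: "'a::comm_ring_1 bipoly"
  where "varY = Poly_Mapping.single (0, 1) 1"

definition bscale :: "'a::comm_ring_1 \<Rightarrow> 'a bipoly \<Rightarrow> 'a bipoly"
  where "bscale c p = Poly_Mapping.single 0 c * p"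

lemma lookup_bscale: "Poly_Mapping.lookup (bscale c p) m = c * Poly_Mapping.lookup p m"
  unfolding bscale_def mult_map_scale_conv_mult [symmetric]
  by (simp add: Poly_Mapping.map.rep_eq when_def)

global_interpretation bipoly: vector_space "bscale :: 'a::field \<Rightarrow> 'a bipoly \<Rightarrow> 'a bipoly"
  by unfold_locales
    (simp_all add: bscale_def algebra_simps single_add mult_single flip: mult.assoc)

text \<open>The automorphism of \<open>F[x,y]\<close> interchanging \<open>x\<close> and \<open>y\<close>; see \<open>psi_varX\<close>, \<open>psi_mult\<close>, \<open>psi_psi\<close> below.\<close>

definition psi :: "'a::comm_ring_1 bipoly \<Rightarrow> 'a bipoly"
  where "psi = Poly_Mapping.map_key prod.swap"

definition subalgebra :: "'a::field bipoly set \<Rightarrow> bool"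
  where "subalgebra A \<longleftrightarrow> bipoly.subspace A \<and> (\<forall>p\<in>A. \<forall>q\<in>A. p * q \<in> A)"

definition is_direct_sum :: "'a::field bipoly set \<Rightarrow> 'a bipoly set \<Rightarrow> 'a bipoly set \<Rightarrow> bool"
  where "is_direct_sum W U V \<longleftrightarrow>
    bipoly.subspace U \<and> bipoly.subspace V \<and> W = {u + v |u v. u \<in> U \<and> v \<in> V} \<and> U \<inter> V = {0}"

definition has_monomial_basis :: "'a::field bipoly set \<Rightarrow> bool"
  where "has_monomial_basis A \<longleftrightarrow>
    (\<exists>M. M \<subseteq> {varX ^ k * varY ^ l |k l. True} \<and> bipoly.independent M \<and> bipoly.span M = A)"

text \<open>\<open>0\<close> belongs to every subspace, so \<open>A \<noteq> {0}\<close> says that the subalgebra \<open>A\<close> is nonzero.\<close>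

definition monomial_decomposition :: "'a::field bipoly set \<Rightarrow> 'a bipoly set \<Rightarrow> bool"
  where "monomial_decomposition A B \<longleftrightarrow>
    subalgebra A \<and> subalgebra B \<and> A \<noteq> {0} \<and> B \<noteq> {0} \<and> is_direct_sum UNIV A B \<and>
    has_monomial_basis A \<and> has_monomial_basis B"

text \<open>Viewing the ring as a module over itself, the generated submodule is the generated ideal.\<close>

definition ideal_generated :: "'a::comm_ring_1 bipoly set \<Rightarrow> 'a bipoly set"
  where "ideal_generated = module.span (*)"

definition zero_const_polys :: "'a::field bipoly set"
  where "zero_const_polys = {p. Poly_Mapping.lookup p (0, 0) = 0}"

definition const_polys :: "'a::field bipoly set"
  where "const_polys = range (\<lambda>c. bscale c 1)"

definition polys_y :: "'a::field bipoly set"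
  where "polys_y = bipoly.span (range (\<lambda>l. varY ^ l))"

text \<open>The span of the non-constant monomials \<open>x^k y^l\<close> whose exponents satisfy \<open>P\<close>.\<close>

definition Span_mon :: "(nat \<Rightarrow> nat \<Rightarrow> bool) \<Rightarrow> 'a::field bipoly set"
  where "Span_mon P = bipoly.span {varX ^ k * varY ^ l |k l. (k, l) \<noteq> (0, 0) \<and> P k l}"

lemma monomial_eq_single: "varX ^ k * varY ^ l = Poly_Mapping.single (k, l) (1::'a::comm_ring_1)"
proof -
  have "varX ^ k = Poly_Mapping.single (k, 0) (1::'a)"
    by (induction k) (simp_all add: varX_def mult_single flip: single_one zero_prod_def)
  moreover have "varY ^ l = Poly_Mapping.single (0, l) (1::'a)"
    by (induction l) (simp_all add: varY_def mult_single flip: single_one zero_prod_def)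
  ultimately show ?thesis
    by (simp add: mult_single)
qed

lemma psi_single: "psi (Poly_Mapping.single (k, l) c) = Poly_Mapping.single (l, k) c"
  using map_key_single [of prod.swap "(l, k)" c] by (simp add: psi_def)

lemma psi_varX: "psi varX = varY" and psi_varY: "psi varY = varX"
  by (simp_all add: varX_def varY_def psi_single)

lemma psi_one: "psi 1 = 1"
  using psi_single [of 0 0 1] by (simp flip: single_one add: zero_prod_def)

lemma psi_add: "psi (p + q) = psi p + psi q"
  by (simp add: psi_def map_key_plus)

lemma psi_psi: "psi (psi p) = p"
  by (simp add: psi_def map_key_compose map_key_id id_def)

lemma psi_mult: "psi (p * q) = psi p * psi q"
proof -
  have ind: "P r" if 0: "P 0" and s: "\<And>k c. P (Poly_Mapping.single k c)"
    and a: "\<And>u v. P u \<Longrightarrow> P v \<Longrightarrow> P (u + v)" for P and r :: "'a bipoly"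
  proof (induction r rule: update_induct)
    case const then show ?case by (rule 0)
  next
    case (update f k b)
    then have "Poly_Mapping.update k b f = f + Poly_Mapping.single k b"
      by (auto intro!: poly_mapping_eqI
          simp: lookup_update lookup_add lookup_single when_def in_keys_iff)
    then show ?case using a [OF update(3) s] by simp
  qed
  have psi0: "psi 0 = (0::'a bipoly)" by (simp add: psi_def)
  have *: "psi (Poly_Mapping.single m c * q) = psi (Poly_Mapping.single m c) * psi q" for m c
    by (induction q rule: ind; cases m)
      (auto simp: psi0 psi_add distrib_left mult_single psi_single split_paired_all)
  show ?thesis
    by (induction p rule: ind) (simp_all add: psi0 psi_add distrib_right *)
qed

lemma psi_bscale: "psi (bscale c p) = bscale c (psi p)"
  by (simp add: bscale_def psi_mult zero_prod_def psi_single)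

lemma ideal_generated_singleton: "ideal_generated {p} = {q * p |q. True}"
proof -
  interpret ring_module: module "(*) :: 'a bipoly \<Rightarrow> _ \<Rightarrow> _"
    by unfold_locales (simp_all add: algebra_simps)
  show ?thesis
    by (auto simp: ideal_generated_def ring_module.span_singleton)
qed

end

theory Submission
  imports Defs
begin

text \<open>
  A subspace with a monomial basis is determined by the set \<open>S \<subseteq> \<nat>\<^sup>2\<close> of its exponents, and it is a
  subalgebra exactly when \<open>S\<close> is closed under addition. So the decompositions correspond to the
  partitions of \<open>\<nat>\<^sup>2\<close> into two nonempty sets closed under addition (\<open>monomial_decomposition_iff\<close>),
  and the theorem is a statement about lattice points.
  
  Let \<open>S\<close> and its complement form such a partition. If \<open>(1, 0)\<close> and \<open>(0, 1)\<close> lie on the same side,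
  so does every nonzero point, because it is a sum of copies of these two, and the origin is left for
  the other part: one summand consists of the constants.
  Otherwise, exchanging the two parts and exchanging the coordinates if necessary, one may assume
  \<open>0 \<in> S\<close>, \<open>(1, 0) \<in> S\<close> and \<open>(0, 1) \<notin> S\<close>. Now slopes separate the two parts: a nonzero \<open>(k, l) \<in> S\<close>
  has strictly smaller slope \<open>l / k\<close> than any \<open>(k', l') \<notin> S\<close> (\<open>slope_less\<close>). Indeed,
  if \<open>l' / k' \<le> l / k\<close>, then \<open>k' (k, l)\<close> is \<open>k (k', l')\<close> plus a multiple of \<open>(0, 1)\<close>, so
  it would belong to both parts. Let \<open>\<alpha>\<close> be the supremum of the slopes in \<open>S\<close>. The strictness puts the
  whole ray of slope \<open>\<alpha>\<close> on one side, so apart from the origin \<open>S\<close> is given by \<open>l < \<alpha> k\<close> or by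
  \<open>l \<le> \<alpha> k\<close>; for irrational \<open>\<alpha>\<close> the two conditions agree off the origin. The extreme slopes
  \<open>\<alpha> = \<infinity>\<close> and, after exchanging the coordinates, \<open>\<alpha> = 0\<close> give the decompositions into the
  polynomials in \<open>y\<close> and the ideal of \<open>x\<close>, with the constants placed in either summand
  (\<open>splitting_lower_sector\<close>).
\<close>

section \<open>Spans of monomials\<close>

definition mon_span :: "(nat \<times> nat) set \<Rightarrow> 'a::field bipoly set"
  where "mon_span S = {p. Poly_Mapping.keys p \<subseteq> S}"

definition monomial :: "nat \<times> nat \<Rightarrow> 'a::field bipoly"
  where "monomial m = Poly_Mapping.single m 1"

lemma monomial_mult: "monomial m * monomial n = (monomial (m + n) :: 'a::field bipoly)"
  by (simp add: monomial_def mult_single)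

lemma monomial_mem_mon_span_iff: "(monomial m :: 'a::field bipoly) \<in> mon_span S \<longleftrightarrow> m \<in> S"
  by (simp add: monomial_def mon_span_def)

lemma inj_monomial: "inj (monomial :: _ \<Rightarrow> 'a::field bipoly)"
proof (rule injI)
  fix m n :: "nat \<times> nat"
  assume "(monomial m :: 'a bipoly) = monomial n"
  then have "Poly_Mapping.keys (monomial m :: 'a bipoly) = Poly_Mapping.keys (monomial n :: 'a bipoly)"
    by simp
  then show "m = n"
    by (simp add: monomial_def)
qed

lemma subspace_mon_span: "bipoly.subspace (mon_span S :: 'a::field bipoly set)"
proof (rule bipoly.subspaceI)
  show "p + q \<in> mon_span S" if "p \<in> mon_span S" "q \<in> mon_span S" for p q :: "'a bipoly"
    using that keys_add [of p q] by (auto simp: mon_span_def)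
  show "bscale c p \<in> mon_span S" if "p \<in> mon_span S" for c and p :: "'a bipoly"
    using that by (auto simp: mon_span_def lookup_bscale in_keys_iff subset_iff)
qed (simp add: mon_span_def)

lemma span_monomials: "bipoly.span (monomial ` S) = (mon_span S :: 'a::field bipoly set)"
proof (rule antisym)
  show "bipoly.span (monomial ` S) \<subseteq> (mon_span S :: 'a bipoly set)"
    by (rule bipoly.span_minimal)
      (auto simp: monomial_mem_mon_span_iff intro: subspace_mon_span)
  show "(mon_span S :: 'a bipoly set) \<subseteq> bipoly.span (monomial ` S)"
  proof
    fix p :: "'a bipoly"
    assume p: "p \<in> mon_span S"
    have "p = (\<Sum>m\<in>Poly_Mapping.keys p. bscale (Poly_Mapping.lookup p m) (monomial m))"
      by (rule poly_mapping_eqI)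
        (auto simp: lookup_sum lookup_bscale monomial_def lookup_single when_def in_keys_iff
          if_distrib cong: if_cong)
    also have "\<dots> \<in> bipoly.span (monomial ` S)"
      using p by (intro bipoly.span_sum bipoly.span_scale bipoly.span_base)
        (auto simp: mon_span_def)
    finally show "p \<in> bipoly.span (monomial ` S)" .
  qed
qed

text \<open>
  By \<open>span_monomials\<close>, the span of the monomials other than a given one is described by keys, and the
  given monomial visibly has a key outside.
\<close>

lemma independent_monomials: "bipoly.independent (monomial ` S :: 'a::field bipoly set)"
proof -
  have "(monomial m :: 'a bipoly) \<notin> bipoly.span (monomial ` S - {monomial m})" for m
  proof -
    have "monomial ` S - {monomial m} = (monomial ` (S - {m}) :: 'a bipoly set)"
      using inj_monomial [where 'a = 'a] by (auto dest: injD)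
    then show ?thesis
      by (simp add: span_monomials monomial_mem_mon_span_iff)
  qed
  then show ?thesis
    by (auto simp: bipoly.dependent_def)
qed

lemma monomials_eq: "{varX ^ k * varY ^ l |k l. P k l} = monomial ` {(k, l). P k l}"
  by (auto simp: monomial_eq_single monomial_def)

lemma has_monomial_basis_iff:
  fixes A :: "'a::field bipoly set"
  shows "has_monomial_basis A \<longleftrightarrow> (\<exists>S. A = mon_span S)"
proof
  assume "has_monomial_basis A"
  then obtain M :: "'a bipoly set" where M: "M \<subseteq> range monomial" "bipoly.span M = A"
    unfolding has_monomial_basis_def monomials_eq by auto
  then obtain S where "M = monomial ` S"
    by (auto simp: subset_image_iff)
  with M show "\<exists>S. A = mon_span S"
    by (auto simp: span_monomials)
next
  assume "\<exists>S. A = mon_span S"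
  then obtain S where "A = mon_span S" ..
  then show "has_monomial_basis A"
    unfolding has_monomial_basis_def monomials_eq
    by (intro exI [of _ "monomial ` S"]) (simp add: span_monomials independent_monomials image_mono)
qed

lemma mon_span_Int: "mon_span S \<inter> mon_span T = mon_span (S \<inter> T)"
  by (auto simp: mon_span_def)

lemma mon_span_UNIV: "mon_span UNIV = UNIV"
  by (simp add: mon_span_def)

lemma inj_mon_span: "(mon_span S :: 'a::field bipoly set) = mon_span T \<longleftrightarrow> S = T"
  by (metis monomial_mem_mon_span_iff subsetI subset_antisym)

lemma mon_span_eq_zero_iff: "(mon_span S :: 'a::field bipoly set) = {0} \<longleftrightarrow> S = {}"
proof -
  have "(mon_span {} :: 'a bipoly set) = {0}"
    by (auto simp: mon_span_def)
  then show ?thesis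
    using inj_mon_span [of S "{}", where 'a = 'a] by simp
qed

text \<open>
  This turns every direct sum in the classification into a disjoint union of exponent sets.
\<close>

lemma is_direct_sum_mon_span_iff:
  fixes W :: "'a::field bipoly set"
  shows "is_direct_sum W (mon_span S) (mon_span T) \<longleftrightarrow> W = mon_span (S \<union> T) \<and> S \<inter> T = {}"
proof -
  have "{u + v |u v. u \<in> mon_span S \<and> v \<in> mon_span T} = (mon_span (S \<union> T) :: 'a bipoly set)"
    by (simp add: image_Un bipoly.span_Un flip: span_monomials)
  then show ?thesis
    by (auto simp: is_direct_sum_def subspace_mon_span mon_span_Int mon_span_eq_zero_iff)
qed

definition add_closed :: "'b::plus set \<Rightarrow> bool"
  where "add_closed S \<longleftrightarrow> (\<forall>a\<in>S. \<forall>b\<in>S. a + b \<in> S)"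

lemma subalgebra_mon_span_iff:
  "subalgebra (mon_span S :: 'a::field bipoly set) \<longleftrightarrow> add_closed S"
proof
  assume "subalgebra (mon_span S :: 'a bipoly set)"
  then have "(monomial m * monomial n :: 'a bipoly) \<in> mon_span S" if "m \<in> S" "n \<in> S" for m n
    using that by (simp add: subalgebra_def monomial_mem_mon_span_iff)
  then show "add_closed S"
    by (simp add: monomial_mult monomial_mem_mon_span_iff add_closed_def)
next
  assume "add_closed S"
  then have "p * q \<in> mon_span S" if "p \<in> mon_span S" "q \<in> mon_span S" for p q :: "'a bipoly"
    using that keys_mult [of p q] by (fastforce simp: mon_span_def add_closed_def)
  then show "subalgebra (mon_span S :: 'a bipoly set)"
    by (simp add: subalgebra_def subspace_mon_span)
qed

lemma psi_image_mon_span: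
  "psi ` mon_span S = (mon_span (prod.swap -` S) :: 'a::field bipoly set)"
proof -
  have keys: "Poly_Mapping.keys (psi p) = prod.swap -` Poly_Mapping.keys p" for p :: "'a bipoly"
    by (auto simp: psi_def keys_map_key)
  show ?thesis
  proof (intro antisym subsetI)
    fix p :: "'a bipoly"
    assume "p \<in> mon_span (prod.swap -` S)"
    then have "psi p \<in> mon_span S"
      by (auto simp: mon_span_def keys)
    then show "p \<in> psi ` mon_span S"
      by (metis psi_psi image_eqI)
  qed (auto simp: mon_span_def keys)
qed

lemma zero_const_polys_eq: "zero_const_polys = mon_span (- {0})"
  by (auto simp: zero_const_polys_def mon_span_def in_keys_iff zero_prod_def)

lemma const_polys_eq: "const_polys = (mon_span {0} :: 'a::field bipoly set)"
  using span_monomials [of "{0}", where 'a = 'a]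
  by (simp add: const_polys_def bipoly.span_singleton monomial_def)

lemma polys_y_eq: "polys_y = (mon_span {(k, l). k = 0} :: 'a::field bipoly set)"
proof -
  have "range (\<lambda>l. varY ^ l) = (monomial ` {(k, l). k = 0} :: 'a bipoly set)"
    using monomial_eq_single [of 0, where 'a = 'a] by (auto simp: monomial_def)
  then show ?thesis
    by (simp add: polys_y_def span_monomials)
qed

lemma Span_mon_eq: "Span_mon P = mon_span {(k, l). (k, l) \<noteq> (0, 0) \<and> P k l}"
  by (simp add: Span_mon_def monomials_eq span_monomials)

text \<open>
  The ideal is also an \<open>F\<close>-subspace, so for the inclusion from right to left it is enough to divide
  each monomial with positive exponent of \<open>x\<close> by \<open>x\<close>.
\<close>

lemma ideal_varX_eq: "ideal_generated {varX} = (mon_span {(k, l). 0 < k} :: 'a::field bipoly set)"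
proof (rule antisym)
  show "ideal_generated {varX} \<subseteq> (mon_span {(k, l). 0 < k} :: 'a bipoly set)"
  proof
    fix p :: "'a bipoly"
    assume "p \<in> ideal_generated {varX}"
    then obtain q where "p = q * varX"
      by (auto simp: ideal_generated_singleton)
    then show "p \<in> mon_span {(k, l). 0 < k}"
      using keys_mult [of q varX] by (auto simp: mon_span_def varX_def)
  qed
  have "bipoly.subspace (ideal_generated {varX :: 'a bipoly})"
  proof (rule bipoly.subspaceI)
    show "0 \<in> ideal_generated {varX :: 'a bipoly}"
      by (auto simp: ideal_generated_singleton intro: exI [of _ 0])
    show "p + q \<in> ideal_generated {varX}"
      if "p \<in> ideal_generated {varX}" "q \<in> ideal_generated {varX}" for p q :: "'a bipoly"
      using that by (auto simp: ideal_generated_singleton simp flip: distrib_right)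
    show "bscale c p \<in> ideal_generated {varX}"
      if "p \<in> ideal_generated {varX}" for c and p :: "'a bipoly"
      using that by (auto simp: ideal_generated_singleton bscale_def simp flip: mult.assoc)
  qed
  moreover have "(monomial m :: 'a bipoly) \<in> ideal_generated {varX}"
    if "m \<in> {(k, l). 0 < k}" for m
  proof -
    obtain k l where m: "m = (Suc k, l)"
      using \<open>m \<in> _\<close> by (cases m; cases "fst m") auto
    then have "(monomial m :: 'a bipoly) = monomial (k, l) * varX"
      by (simp add: monomial_def varX_def mult_single)
    then show ?thesis
      by (auto simp: ideal_generated_singleton)
  qed
  ultimately show "(mon_span {(k, l). 0 < k} :: 'a bipoly set) \<subseteq> ideal_generated {varX}"
    unfolding span_monomials [symmetric] by (intro bipoly.span_minimal) auto
qed

section \<open>Splittings of the exponent lattice\<close>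

definition splitting :: "'b::plus set \<Rightarrow> bool"
  where "splitting S \<longleftrightarrow> S \<noteq> {} \<and> - S \<noteq> {} \<and> add_closed S \<and> add_closed (- S)"

lemma splitting_Compl: "splitting (- S) \<longleftrightarrow> splitting S"
  by (auto simp: splitting_def)

lemma splitting_swap:
  fixes S :: "(nat \<times> nat) set"
  shows "splitting (prod.swap -` S) \<longleftrightarrow> splitting S"
proof -
  have dir: "splitting (prod.swap -` R)" if "splitting R" for R :: "(nat \<times> nat) set"
  proof -
    have "add_closed (prod.swap -` T)" if "add_closed T" for T :: "(nat \<times> nat) set"
      using that by (fastforce simp: add_closed_def prod.swap_def)
    moreover have "prod.swap -` T \<noteq> {}" if "T \<noteq> {}" for T :: "(nat \<times> nat) set"
      using that by (metis swap_swap vimageI2 ex_in_conv)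
    moreover have "- (prod.swap -` R) = prod.swap -` (- R)"
      by (rule vimage_Compl [symmetric])
    ultimately show ?thesis
      using that unfolding splitting_def by metis
  qed
  have "prod.swap -` (prod.swap -` S) = S"
    by auto
  with dir [of S] dir [of "prod.swap -` S"] show ?thesis
    by auto
qed

lemma add_closed_multiple:
  fixes v :: "nat \<times> nat"
  assumes "add_closed S" and "v \<in> S" and "0 < n"
  shows "(n * fst v, n * snd v) \<in> S"
  using \<open>0 < n\<close>
proof (induction n rule: nat_induct_non_zero)
  case (Suc n)
  then have "v + (n * fst v, n * snd v) \<in> S"
    using assms by (simp add: add_closed_def)
  then show ?case
    by (cases v) simp
qed (use \<open>v \<in> S\<close> in simp)

text \<open>
  The reduction from algebra to combinatorics: all conditions on the pair of subalgebras become
  conditions on the exponent set of the first one, the second exponent set being its complement.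
\<close>

lemma monomial_decomposition_iff:
  fixes A B :: "'a::field bipoly set"
  shows "monomial_decomposition A B \<longleftrightarrow>
    (\<exists>S. splitting S \<and> A = mon_span S \<and> B = mon_span (- S))"
proof
  assume dec: "monomial_decomposition A B"
  then obtain S T where AB: "A = mon_span S" "B = mon_span T"
    by (auto simp: monomial_decomposition_def has_monomial_basis_iff)
  have "(UNIV :: 'a bipoly set) = mon_span (S \<union> T)" and "S \<inter> T = {}"
    using dec by (auto simp: monomial_decomposition_def AB is_direct_sum_mon_span_iff)
  then have "T = - S"
    using inj_mon_span [of UNIV, where 'a = 'a] by (auto simp: mon_span_UNIV)
  moreover have "splitting S"
    using dec unfolding \<open>T = - S\<close> AB
    by (simp add: monomial_decomposition_def splitting_def subalgebra_mon_span_iff mon_span_eq_zero_iff)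
  ultimately show "\<exists>S. splitting S \<and> A = mon_span S \<and> B = mon_span (- S)"
    using AB by blast
next
  assume "\<exists>S. splitting S \<and> A = mon_span S \<and> B = mon_span (- S)"
  then show "monomial_decomposition A B"
    by (auto simp: monomial_decomposition_def splitting_def subalgebra_mon_span_iff
        mon_span_eq_zero_iff is_direct_sum_mon_span_iff has_monomial_basis_iff mon_span_UNIV)
qed

text \<open>
  The heart of the classification. The inequality says \<open>l / k < l' / k'\<close>, written without
  division so that it also covers points with \<open>k' = 0\<close>. If it fails, then
  \<open>k' (k, l) = k (k', l') + (l k' - l' k) (0, 1)\<close> with nonnegative coefficients: the left-hand side
  lies in \<open>S\<close> and the right-hand side in the complement. The hypothesis \<open>0 \<in> S\<close> makes the left-hand
  side a member of \<open>S\<close> even when \<open>k' = 0\<close>.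
\<close>

lemma slope_less:
  fixes k l k' l' :: nat
  assumes "add_closed S" and "add_closed (- S)" and "0 \<in> S" and "(0, 1) \<notin> S"
    and kl: "(k, l) \<in> S" "(k, l) \<noteq> 0" and kl': "(k', l') \<notin> S"
  shows "l * k' < l' * k"
proof (rule ccontr)
  assume "\<not> l * k' < l' * k"
  then have le: "l' * k \<le> l * k'"
    by simp
  have e2: "(0, n) \<notin> S" if "0 < n" for n
    using add_closed_multiple [of "- S" "(0, 1)" n] assms that by simp
  \<comment> \<open>A point of \<open>S\<close> with \<open>k = 0\<close> would be a positive multiple of \<open>(0, 1)\<close>.\<close>
  have "0 < k"
    using kl e2 [of l] by (cases "k = 0") (auto simp: zero_prod_def)
  have "(k * k', k * l') \<in> - S"
    using add_closed_multiple [of "- S" "(k', l')" k] assms \<open>0 < k\<close> by simp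
  have "(k * k', l * k') \<notin> S"
  proof (cases "l' * k = l * k'")
    case True
    then show ?thesis
      using \<open>(k * k', k * l') \<in> - S\<close> by (simp add: mult.commute)
  next
    case False
    then have "(0, l * k' - l' * k) \<in> - S"
      using e2 le by simp
    then have "(k * k', k * l') + (0, l * k' - l' * k) \<in> - S"
      using \<open>(k * k', k * l') \<in> - S\<close> \<open>add_closed (- S)\<close> unfolding add_closed_def by blast
    then show ?thesis
      using le by (simp add: mult.commute)
  qed
  moreover have "(k * k', l * k') \<in> S"
    using add_closed_multiple [of S "(k, l)" k'] assms
    by (cases "k' = 0") (auto simp: zero_prod_def mult.commute)
  ultimately show False ..
qed

text \<open>
  The boundary slope \<open>\<alpha>\<close> is the supremum of the slopes of nonzero points of \<open>S\<close>. By \<open>slope_less\<close> it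
  is finite unless the complement lies on the vertical axis, it bounds the slopes in \<open>S\<close> from above
  and those outside from below, and points of slope exactly \<open>\<alpha>\<close> cannot occur on both sides. The middle
  alternative is the sector of slope \<open>\<alpha> = 0\<close>, which consists of the horizontal axis.
\<close>

lemma splitting_lower_sector:
  assumes S: "add_closed S" "add_closed (- S)" and "0 \<in> S" "(1, 0) \<in> S" "(0, 1) \<notin> S"
  shows "S = insert 0 {(k, l). 0 < k} \<or> S = {(k, l). l = 0} \<or>
    (\<exists>\<alpha>::real. 0 < \<alpha> \<and>
      (S = insert 0 {(k, l). real l < \<alpha> * real k} \<or> S = {(k, l). real l \<le> \<alpha> * real k}))"
proof -
  have less: "l * k' < l' * k" if "(k, l) \<in> S" "(k, l) \<noteq> 0" "(k', l') \<notin> S" for k l k' l'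
    using slope_less [of S] assms that by blast
  have pos: "0 < k" if "(k, l) \<in> S" "(k, l) \<noteq> 0" for k l
    using less [OF that \<open>(0, 1) \<notin> S\<close>] by simp
  show ?thesis
  proof (cases "\<forall>k l. (k, l) \<notin> S \<longrightarrow> k = 0")
    case True
    then have "S = insert 0 {(k, l). 0 < k}"
      using pos \<open>0 \<in> S\<close> by fastforce
    then show ?thesis ..
  next
    case False
    then obtain k0 l0 where kl0: "(k0, l0) \<notin> S" "0 < k0"
      by auto
    \<comment> \<open>The point \<open>(k0, l0)\<close> has finite slope, which bounds all slopes in \<open>S\<close>.\<close>
    define X where "X = {real l / real k |k l. (k, l) \<in> S \<and> (k, l) \<noteq> 0}"
    define \<alpha> where "\<alpha> = Sup X"
    have le_slope: "real l / real k \<le> real l' / real k'"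
      if "(k, l) \<in> S" "(k, l) \<noteq> 0" "(k', l') \<notin> S" "0 < k'" for k l k' l'
    proof -
      have "real (l * k') \<le> real (l' * k)"
        using less [of k l k' l'] that by (simp del: of_nat_mult)
      then show ?thesis
        using pos [of k l] that by (simp add: field_simps)
    qed
    have "0 \<in> X"
      using \<open>(1, 0) \<in> S\<close> by (force simp: X_def zero_prod_def)
    have "bdd_above X"
      using le_slope kl0 by (auto simp: X_def intro!: bdd_aboveI [of _ "real l0 / real k0"])
    have "0 \<le> \<alpha>"
      unfolding \<alpha>_def by (rule cSup_upper) fact+
    have inside: "real l \<le> \<alpha> * real k" if "(k, l) \<in> S" for k l
    proof (cases "(k, l) = 0")
      case False
      then have "real l / real k \<le> \<alpha>"
        unfolding \<alpha>_def using that \<open>bdd_above X\<close> by (intro cSup_upper) (auto simp: X_def)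
      then show ?thesis
        using pos [OF that False] by (simp add: field_simps)
    qed (simp add: zero_prod_def)
    have outside: "\<alpha> * real k' \<le> real l'" if "(k', l') \<notin> S" for k' l'
    proof (cases "k' = 0")
      case False
      have "\<alpha> \<le> real l' / real k'"
        unfolding \<alpha>_def using \<open>0 \<in> X\<close> that le_slope False by (intro cSup_least) (auto simp: X_def)
      then show ?thesis
        using False by (simp add: field_simps)
    qed simp
    \<comment> \<open>The sector is closed or open according to whether the supremum is attained in \<open>S\<close>.\<close>
    show ?thesis
    proof (cases "\<exists>k l. (k, l) \<in> S \<and> (k, l) \<noteq> 0 \<and> real l = \<alpha> * real k")
      case True
      then obtain k l where kl: "(k, l) \<in> S" "(k, l) \<noteq> 0" "real l = \<alpha> * real k"
        by blast
      have "\<alpha> * real k' < real l'" if "(k', l') \<notin> S" for k' l'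
      proof -
        have "real (l * k') < real (l' * k)"
          using less [of k l k' l'] kl that by (simp del: of_nat_mult)
        then have "(\<alpha> * real k') * real k < real l' * real k"
          using kl by (simp add: mult_ac)
        then show ?thesis
          by (simp add: mult_less_cancel_right)
      qed
      then have eq: "S = {(k, l). real l \<le> \<alpha> * real k}"
        using inside by force
      show ?thesis
      proof (cases "\<alpha> = 0")
        case True
        then show ?thesis
          using eq by simp
      next
        case False
        then show ?thesis
          using eq \<open>0 \<le> \<alpha>\<close> by (auto intro!: exI [of _ \<alpha>])
      qed
    next
      case False
      have eq: "S = insert 0 {(k, l). real l < \<alpha> * real k}"
      proof (intro set_eqI iffI)
        fix m assume "m \<in> S"
        then show "m \<in> insert 0 {(k, l). real l < \<alpha> * real k}"
          using inside False by (cases m) (metis (mono_tags, lifting) case_prodI insertCI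
              mem_Collect_eq order.order_iff_strict)
      next
        fix m assume "m \<in> insert 0 {(k, l). real l < \<alpha> * real k}"
        then show "m \<in> S"
          using outside \<open>0 \<in> S\<close> by (cases m) force
      qed
      \<comment> \<open>Since \<open>(1, 0) \<in> S\<close>, an open sector cannot have slope \<open>0\<close>.\<close>
      have "(1, 0) \<in> insert 0 {(k, l). real l < \<alpha> * real k}"
        using \<open>(1, 0) \<in> S\<close> eq by simp
      then have "0 < \<alpha>"
        by (simp add: zero_prod_def)
      then show ?thesis
        using eq by blast
    qed
  qed
qed

text \<open>
  The exponent sets of the first summands. Here \<open>insert 0\<close> adjoins the constants; the closed sectors
  contain the origin anyway.
\<close>

definition standard_splitting :: "(nat \<times> nat) set \<Rightarrow> bool"
  where "standard_splitting R \<longleftrightarrow>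
    R = - {0} \<or> R = {(k, l). 0 < k} \<or> R = insert 0 {(k, l). 0 < k} \<or>
    (\<exists>\<alpha>::real. 0 < \<alpha> \<and>
      (R = insert 0 {(k, l). real l < \<alpha> * real k} \<or> R = {(k, l). real l \<le> \<alpha> * real k}))"

lemma standard_splitting_imp_splitting:
  assumes "standard_splitting R"
  shows "splitting R"
proof -
  have "splitting (insert 0 {(k, l). real l < \<alpha> * real k})" if "0 < \<alpha>" for \<alpha> :: real
    unfolding splitting_def
  proof (intro conjI)
    have "(0, 1) \<in> - insert 0 {(k, l). real l < \<alpha> * real k}"
      by (simp add: zero_prod_def)
    then show "- insert 0 {(k, l). real l < \<alpha> * real k} \<noteq> {}"
      by blast
  qed (auto simp: add_closed_def zero_prod_def distrib_left)
  moreover have "splitting {(k, l). real l \<le> \<alpha> * real k}" if "0 < \<alpha>" for \<alpha> :: real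
    unfolding splitting_def
  proof (intro conjI)
    have "(0, 0) \<in> {(k, l). real l \<le> \<alpha> * real k}" "(0, 1) \<in> - {(k, l). real l \<le> \<alpha> * real k}"
      by simp_all
    then show "{(k, l). real l \<le> \<alpha> * real k} \<noteq> {}" "- {(k, l). real l \<le> \<alpha> * real k} \<noteq> {}"
      by blast+
  qed (auto simp: add_closed_def distrib_left)
  moreover have "splitting (- {0 :: nat \<times> nat})"
    by (auto simp: splitting_def add_closed_def zero_prod_def)
  moreover have "splitting {(k::nat, l::nat). 0 < k}"
    by (auto simp: splitting_def add_closed_def)
  moreover have "splitting (insert 0 {(k::nat, l::nat). 0 < k})"
    by (auto simp: splitting_def add_closed_def zero_prod_def)
  ultimately show ?thesis
    using assms by (auto simp: standard_splitting_def)
qed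

text \<open>
  Taking complements exchanges the two summands; exchanging the coordinates corresponds to the
  automorphism \<open>\<psi>\<close>.
\<close>

definition equivalent_to_standard :: "(nat \<times> nat) set \<Rightarrow> bool"
  where "equivalent_to_standard S \<longleftrightarrow> (\<exists>R. standard_splitting R \<and>
    (S = R \<or> S = - R \<or> S = prod.swap -` R \<or> S = - (prod.swap -` R)))"

lemma equivalent_to_standard_Compl: "equivalent_to_standard (- S) \<longleftrightarrow> equivalent_to_standard S"
  unfolding equivalent_to_standard_def by (metis double_complement)

lemma equivalent_to_standard_swap:
  "equivalent_to_standard (prod.swap -` S) \<longleftrightarrow> equivalent_to_standard S"
proof -
  have swap_swap: "prod.swap -` (prod.swap -` R) = R" for R :: "(nat \<times> nat) set"
    by auto
  have "equivalent_to_standard (prod.swap -` T)" if T: "equivalent_to_standard T" for T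
  proof -
    obtain R where "standard_splitting R"
      and "T = R \<or> T = - R \<or> T = prod.swap -` R \<or> T = - (prod.swap -` R)"
      using T unfolding equivalent_to_standard_def by blast
    moreover from this(2) have "prod.swap -` T = prod.swap -` R \<or> prod.swap -` T = - (prod.swap -` R)
        \<or> prod.swap -` T = R \<or> prod.swap -` T = - R"
      by (elim disjE) (simp_all only: vimage_Compl swap_swap simp_thms)
    ultimately show ?thesis
      unfolding equivalent_to_standard_def by blast
  qed
  from this [of S] this [of "prod.swap -` S"] show ?thesis
    by (auto simp only: swap_swap)
qed

text \<open>
  Both the splittings and the sets equivalent to a standard one are stable under complements and under
  exchanging the coordinates. Together these two operations send \<open>S\<close> to the
  complement of its mirror image, which keeps the conditions \<open>(1, 0) \<in> S\<close> and \<open>(0, 1) \<notin> S\<close> but moves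
  the origin to the other part. Hence one may assume \<open>0 \<in> S\<close>.
\<close>

lemma splitting_imp_equivalent_to_standard:
  assumes "splitting S"
  shows "equivalent_to_standard S"
proof -
  have unmixed: "equivalent_to_standard S"
    if S: "splitting S" and e: "(1, 0) \<in> S" "(0, 1) \<in> S" for S :: "(nat \<times> nat) set"
  proof -
    have "(k, l) \<in> S" if "(k, l) \<noteq> (0, 0)" for k l
    proof -
      have "(k, 0) \<in> S" if "0 < k"
        using add_closed_multiple [of S "(1, 0)" k] S e that by (simp add: splitting_def)
      moreover have "(0, l) \<in> S" if "0 < l"
        using add_closed_multiple [of S "(0, 1)" l] S e that by (simp add: splitting_def)
      moreover have "(k, 0) + (0, l) \<in> S" if "(k, 0) \<in> S" "(0, l) \<in> S"
        using S that unfolding splitting_def add_closed_def by blast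
      ultimately show ?thesis
        using that by (cases "k = 0"; cases "l = 0") (auto simp: zero_prod_def)
    qed
    then have "m = (0, 0)" if "m \<in> - S" for m
      using that by (metis ComplD surj_pair)
    then have "- S \<subseteq> {(0, 0)}"
      by blast
    moreover have "- S \<noteq> {}"
      using S by (simp add: splitting_def)
    ultimately have "S = - {0}"
      unfolding zero_prod_def by blast
    then show ?thesis
      by (auto simp: equivalent_to_standard_def standard_splitting_def)
  qed
  have lower: "equivalent_to_standard S"
    if S: "splitting S" and "0 \<in> S" "(1, 0) \<in> S" "(0, 1) \<notin> S" for S
  proof -
    \<comment> \<open>The horizontal axis is the mirror image of the exponents of polynomials in \<open>y\<close>.\<close>
    have "{(k::nat, l::nat). l = 0} = - (prod.swap -` {(k, l). 0 < k})"
      by auto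
    then have "standard_splitting S \<or> (\<exists>R. standard_splitting R \<and> S = - (prod.swap -` R))"
      using splitting_lower_sector [of S] that unfolding splitting_def standard_splitting_def
      by blast
    then show ?thesis
      by (auto simp: equivalent_to_standard_def)
  qed
  have mixed: "equivalent_to_standard S"
    if S: "splitting S" and e: "(1, 0) \<in> S" "(0, 1) \<notin> S" for S
  proof (cases "0 \<in> S")
    case True
    then show ?thesis
      using lower that by blast
  next
    case False
    then have "equivalent_to_standard (- (prod.swap -` S))"
      using that by (intro lower) (auto simp: splitting_Compl splitting_swap zero_prod_def)
    then show ?thesis
      by (simp add: equivalent_to_standard_Compl equivalent_to_standard_swap)
  qed
  show ?thesis
  proof (cases "(1, 0) \<in> S")
    case True
    then show ?thesis
      using unmixed mixed assms by blast
  next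
    case False
    then have "equivalent_to_standard (- S)"
      using unmixed [of "- S"] mixed [of "- S"] assms by (auto simp: splitting_Compl)
    then show ?thesis
      by (simp add: equivalent_to_standard_Compl)
  qed
qed

lemma splitting_iff_equivalent_to_standard: "splitting S \<longleftrightarrow> equivalent_to_standard S"
  using splitting_imp_equivalent_to_standard standard_splitting_imp_splitting
  by (auto simp: equivalent_to_standard_def splitting_Compl splitting_swap)

section \<open>The classification\<close>

text \<open>
  A line of irrational slope meets the lattice only in the origin, so that the strict and the
  nonstrict sectors of this slope differ at most there.
\<close>

lemma irrational_ray:
  assumes "\<alpha> \<notin> \<rat>"
  shows "real l = \<alpha> * real k \<longleftrightarrow> k = 0 \<and> l = 0"
proof
  assume eq: "real l = \<alpha> * real k"
  show "k = 0 \<and> l = 0"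
  proof (cases "k = 0")
    case False
    then have "\<alpha> = real l / real k"
      using eq by (simp add: field_simps)
    with assms show ?thesis
      by simp
  qed (use eq in simp)
qed simp

lemma is_direct_sum_with_constants_iff:
  fixes W :: "'a::field bipoly set"
  assumes "0 \<notin> S"
  shows "is_direct_sum W (mon_span S) const_polys \<longleftrightarrow> W = mon_span (insert 0 S)"
  using assms by (auto simp: const_polys_eq is_direct_sum_mon_span_iff)

text \<open>
  Here only the translation into exponent sets is at stake. The open and the closed sectors of rational
  slope correspond to separate families of decompositions; for an irrational slope the open sector
  together with the origin equals the closed one, which is why there is a single family with both
  inequalities strict.
\<close>

lemma listed_iff_standard_splitting:
  fixes A B :: "'a::field bipoly set"
  shows "(A = zero_const_polys \<and> B = const_polys)
      \<or> (A = ideal_generated {varX} \<and> B = polys_y)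
      \<or> (is_direct_sum A (ideal_generated {varX}) const_polys \<and> B = polys_y \<inter> zero_const_polys)
      \<or> (\<exists>\<alpha>::real. \<alpha> \<in> \<rat> \<and> \<alpha> > 0 \<and>
            is_direct_sum A (Span_mon (\<lambda>k l. \<alpha> * real k > real l)) const_polys \<and>
            B = Span_mon (\<lambda>k l. \<alpha> * real k \<le> real l))
      \<or> (\<exists>\<alpha>::real. \<alpha> \<in> \<rat> \<and> \<alpha> > 0 \<and>
            is_direct_sum A (Span_mon (\<lambda>k l. \<alpha> * real k \<ge> real l)) const_polys \<and>
            B = Span_mon (\<lambda>k l. \<alpha> * real k < real l))
      \<or> (\<exists>\<alpha>::real. \<alpha> \<notin> \<rat> \<and> \<alpha> > 0 \<and>
            is_direct_sum A (Span_mon (\<lambda>k l. \<alpha> * real k > real l)) const_polys \<and>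
            B = Span_mon (\<lambda>k l. \<alpha> * real k < real l))
    \<longleftrightarrow> (\<exists>R. standard_splitting R \<and> A = mon_span R \<and> B = mon_span (- R))"
    (is "?I \<or> ?II \<or> ?III \<or> (\<exists>\<alpha>. ?IV \<alpha>) \<or> (\<exists>\<alpha>. ?V \<alpha>) \<or> (\<exists>\<alpha>. ?VI \<alpha>) \<longleftrightarrow> _")
proof -
  define pair where "pair R \<longleftrightarrow> A = mon_span R \<and> B = mon_span (- R)" for R
  define upto below where "upto \<alpha> = {(k, l). real l \<le> \<alpha> * real k}"
    and "below \<alpha> = insert 0 {(k, l). real l < \<alpha> * real k}" for \<alpha> :: real
  have I: "?I \<longleftrightarrow> pair (- {0})"
    by (simp add: pair_def zero_const_polys_eq const_polys_eq)
  have II: "?II \<longleftrightarrow> pair {(k, l). 0 < k}"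
  proof -
    have "- {(k::nat, l::nat). 0 < k} = {(k, l). k = 0}"
      by auto
    then show ?thesis
      by (simp add: pair_def ideal_varX_eq polys_y_eq)
  qed
  have III: "?III \<longleftrightarrow> pair (insert 0 {(k, l). 0 < k})"
  proof -
    have "- insert 0 {(k::nat, l::nat). 0 < k} = {(k, l). k = 0} \<inter> - {0}"
      by auto
    then show ?thesis
      by (simp add: pair_def ideal_varX_eq polys_y_eq zero_const_polys_eq mon_span_Int
          is_direct_sum_with_constants_iff zero_prod_def)
  qed
  have sum_below: "is_direct_sum A (Span_mon (\<lambda>k l. \<alpha> * real k > real l)) const_polys \<longleftrightarrow>
    A = mon_span (below \<alpha>)" for \<alpha>
  proof -
    have "insert 0 {(k, l). (k, l) \<noteq> (0, 0) \<and> real l < \<alpha> * real k} = below \<alpha>"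
      by (auto simp: below_def zero_prod_def)
    then show ?thesis
      by (simp add: Span_mon_eq is_direct_sum_with_constants_iff zero_prod_def)
  qed
  have IV: "?IV \<alpha> \<longleftrightarrow> \<alpha> \<in> \<rat> \<and> \<alpha> > 0 \<and> pair (below \<alpha>)" for \<alpha>
  proof -
    have "- below \<alpha> = {(k, l). (k, l) \<noteq> (0, 0) \<and> \<alpha> * real k \<le> real l}"
      by (auto simp: below_def zero_prod_def)
    then show ?thesis
      unfolding sum_below unfolding pair_def Span_mon_eq by simp
  qed
  have Compl_upto: "- upto \<alpha> = {(k, l). (k, l) \<noteq> (0, 0) \<and> \<alpha> * real k < real l}" for \<alpha>
    by (auto simp: upto_def not_le intro!: gr0I)
  have V: "?V \<alpha> \<longleftrightarrow> \<alpha> \<in> \<rat> \<and> \<alpha> > 0 \<and> pair (upto \<alpha>)" for \<alpha>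
  proof -
    have "insert 0 {(k, l). (k, l) \<noteq> (0, 0) \<and> real l \<le> \<alpha> * real k} = upto \<alpha>"
      by (auto simp: upto_def zero_prod_def)
    then show ?thesis
      by (simp add: Compl_upto pair_def Span_mon_eq is_direct_sum_with_constants_iff zero_prod_def)
  qed
  have below_eq_upto: "below \<alpha> = upto \<alpha>" if "\<alpha> \<notin> \<rat>" for \<alpha>
  proof -
    have "real l \<le> \<alpha> * real k \<longleftrightarrow> real l < \<alpha> * real k \<or> (k, l) = (0, 0)" for k l
      using irrational_ray [OF that, of l k] by (auto simp: order.order_iff_strict)
    then show ?thesis
      by (auto simp: below_def upto_def zero_prod_def)
  qed
  have VI: "?VI \<alpha> \<longleftrightarrow> \<alpha> \<notin> \<rat> \<and> \<alpha> > 0 \<and> pair (below \<alpha>)" for \<alpha>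
  proof (cases "\<alpha> \<in> \<rat>")
    case False
    have "- below \<alpha> = {(k, l). (k, l) \<noteq> (0, 0) \<and> \<alpha> * real k < real l}"
      using below_eq_upto [OF False] Compl_upto [of \<alpha>] by simp
    then show ?thesis
      unfolding sum_below unfolding pair_def Span_mon_eq by simp
  qed simp
  have "(\<exists>R. standard_splitting R \<and> pair R) \<longleftrightarrow>
    pair (- {0}) \<or> pair {(k, l). 0 < k} \<or> pair (insert 0 {(k, l). 0 < k}) \<or>
    (\<exists>\<alpha>. 0 < \<alpha> \<and> (pair (below \<alpha>) \<or> pair (upto \<alpha>)))"
    unfolding standard_splitting_def below_def upto_def by blast
  then show ?thesis
    unfolding I II III IV V VI unfolding pair_def [symmetric]
    using below_eq_upto by metis
qed

theorem theorem4p1: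
  fixes A B :: "'a::field_char_0 bipoly set"
  shows "monomial_decomposition A B \<longleftrightarrow>
    (\<exists>A' B'. ({A, B} = {A', B'} \<or> {A, B} = {psi ` A', psi ` B'}) \<and>
      ( (A' = zero_const_polys \<and> B' = const_polys)
      \<or> (A' = ideal_generated {varX} \<and> B' = polys_y)
      \<or> (is_direct_sum A' (ideal_generated {varX}) const_polys \<and> B' = polys_y \<inter> zero_const_polys)
      \<or> (\<exists>\<alpha>::real. \<alpha> \<in> \<rat> \<and> \<alpha> > 0 \<and>
            is_direct_sum A' (Span_mon (\<lambda>k l. \<alpha> * real k > real l)) const_polys \<and>
            B' = Span_mon (\<lambda>k l. \<alpha> * real k \<le> real l))
      \<or> (\<exists>\<alpha>::real. \<alpha> \<in> \<rat> \<and> \<alpha> > 0 \<and>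
            is_direct_sum A' (Span_mon (\<lambda>k l. \<alpha> * real k \<ge> real l)) const_polys \<and>
            B' = Span_mon (\<lambda>k l. \<alpha> * real k < real l))
      \<or> (\<exists>\<alpha>::real. \<alpha> \<notin> \<rat> \<and> \<alpha> > 0 \<and>
            is_direct_sum A' (Span_mon (\<lambda>k l. \<alpha> * real k > real l)) const_polys \<and>
            B' = Span_mon (\<lambda>k l. \<alpha> * real k < real l))))"
proof -
  have "monomial_decomposition A B \<longleftrightarrow>
    (\<exists>R. standard_splitting R \<and>
      (\<exists>S. (S = R \<or> S = - R \<or> S = prod.swap -` R \<or> S = - (prod.swap -` R)) \<and>
        A = mon_span S \<and> B = mon_span (- S)))"
    unfolding monomial_decomposition_iff splitting_iff_equivalent_to_standard
      equivalent_to_standard_def by blast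
  also have "\<dots> \<longleftrightarrow> (\<exists>R. standard_splitting R \<and>
    ({A, B} = {mon_span R, mon_span (- R)} \<or>
     {A, B} = {mon_span (prod.swap -` R), mon_span (- (prod.swap -` R))}))"
    unfolding doubleton_eq_iff
    by (intro arg_cong [where f = Ex] ext conj_cong refl)
      (simp add: conj_disj_distribR ex_disj_distrib disj.assoc)
  also have "\<dots> \<longleftrightarrow> (\<exists>A' B'. ({A, B} = {A', B'} \<or> {A, B} = {psi ` A', psi ` B'}) \<and>
    (\<exists>R. standard_splitting R \<and> A' = mon_span R \<and> B' = mon_span (- R)))"
  proof -
    have psi_pair: "{psi ` mon_span R, psi ` mon_span (- R)} =
      {mon_span (prod.swap -` R), mon_span (- (prod.swap -` R)) :: 'a bipoly set}" for R
      by (simp add: psi_image_mon_span vimage_Compl)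
    have "(\<exists>A' B'. Q A' B' \<and> (\<exists>R. standard_splitting R \<and> A' = mon_span R \<and> B' = mon_span (- R)))
      \<longleftrightarrow> (\<exists>R. standard_splitting R \<and> Q (mon_span R) (mon_span (- R)))"
      for Q :: "'a bipoly set \<Rightarrow> 'a bipoly set \<Rightarrow> bool"
      by blast
    from this [of "\<lambda>A' B'. {A, B} = {A', B'} \<or> {A, B} = {psi ` A', psi ` B'}"] show ?thesis
      unfolding psi_pair by (rule sym)
  qed
  finally show ?thesis
    unfolding listed_iff_standard_splitting .
qed

end
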